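(* Let $(p_n)$ be a sequence with $0<\liminf_{n\to\infty} p_n\leq \limsup_{n\to\infty} p_n<1$, let $p=p_n$, $q=q_n=1-p_n$, and let $j=j_n$ be integers with $0\leq j_n\leq n$. Put $V=npq$ and $y=\frac{j-np+1/2}{\sqrt{V}}$. Then, as $n\to\infty$, \[ \sum_{k=0}^j \binom{n}{k}p^k q^{n-k}=\Phi(y)+ \frac{e^{-\frac{1}{2}y^2}}{\sqrt{2\pi}}\Big(\frac{P_1}{\sqrt{V}}+\frac{P_2}{V}+\frac{P_3}{V^{3/2}}+\frac{P_4}{V^2}\Big)+O\Big(\frac{1}{n^{5/2}}\Big), \] where \begin{itemize} \item $P_1=\frac{1}{6}(q-p)(1-y^2)$, \item $P_2=y\big[\frac{1}{72}(-3+7y^2-y^4)-\frac{pq}{36}(-3+11y^2-2y^4)\big]$, \item $P_3=(q-p)\big[\frac{1}{6480}(123+129y^2-384y^4+95y^6-5y^8)-\frac{pq}{3240}(3+69y^2-399y^4+145y^6-10y^8)\big]$, \item $P_4=y\big[\frac{1}{155520}(-4293-1359y^2+6165y^4-1971y^6+185y^8-5y^{10})+\frac{pq}{38880}(3105+1395y^2-7794y^4+2979y^6-325y^8+10y^{10})+\frac{p^2 q^2}{38880}(135-1035y^2+7947y^4-4167y^6+560y^8-20y^{10})\big]$. \end{itemize}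
   Context: $\Phi$ denotes the standard normal cumulative distribution function. *)

theory Defs
  imports "HOL-Probability.Probability" "HOL-Library.Landau_Symbols"
begin

definition Phi :: "real \<Rightarrow> real" where
  "Phi x = (LINT t:{..x}|lborel. std_normal_density t)"

end

theory Submission
  imports Defs "HOL-Computational_Algebra.Polynomial"
begin

text \<open>
  Fix \<open>n\<close> and \<open>j\<close> and let \<open>p\<close> vary. The binomial distribution function \<open>S(p)\<close> has derivative
  \<open>- (n - j) (n choose j) p ^ j q ^ (n - j - 1)\<close>, so it solves \<open>S'' = \<kappa> S'\<close> with the rational drift
  \<open>\<kappa> = j/p - (n - 1 - j)/q\<close>. The expansion \<open>F(p) = \<Phi>(y) + \<phi>(y) (P1/V^(1/2) + ... + P4/V^2)\<close> solves
  the same equation up to a residual \<open>F'' - \<kappa> F' = \<phi>(y) V^(-3/2) R / (p q)^2\<close> with \<open>R\<close> polynomial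
  in \<open>p\<close>, \<open>y\<close> and \<open>V^(-1/2)\<close>; this is a polynomial identity. The function \<open>exp (- y^2 / 4)\<close> is a strict
  supersolution dominating this residual, so the maximum principle on the interval
  \<open>|p - (j + 1/2)/n| \<le> \<epsilon>\<close> bounds \<open>S - F\<close> by \<open>O(n^(-5/2))\<close> plus its values at the end points. There,
  and for all \<open>p\<close> outside the interval, both \<open>S\<close> and \<open>F\<close> are within \<open>O(n^(-3))\<close> of \<open>0\<close> or of \<open>1\<close>.
\<close>

section \<open>Polynomials along a curve\<close>

text \<open>Nesting univariate polynomials turns identities in several variables into computations
  on coefficient lists, which the simplifier can carry out. The outer variable is substituted as a
  constant polynomial.\<close>

definition eval2 :: "real poly poly \<Rightarrow> real \<Rightarrow> real \<Rightarrow> real" where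
  "eval2 X p y = poly (poly X [:y:]) p"

definition eval3 :: "real poly poly poly \<Rightarrow> real \<Rightarrow> real \<Rightarrow> real \<Rightarrow> real" where
  "eval3 X p y w = eval2 (poly X [:[:w:]:]) p y"

lemma eval2_pCons: "eval2 (pCons a X) p y = poly a p + y * eval2 X p y"
  by (simp add: eval2_def)

lemma eval3_pCons: "eval3 (pCons a X) p y w = eval2 a p y + w * eval3 X p y w"
  by (simp add: eval2_def eval3_def)

lemma eval2_add: "eval2 (X + Y) p y = eval2 X p y + eval2 Y p y"
  by (simp add: eval2_def)

lemma eval3_add: "eval3 (X + Y) p y w = eval3 X p y w + eval3 Y p y w"
  and eval3_diff: "eval3 (X - Y) p y w = eval3 X p y w - eval3 Y p y w"
  and eval3_mult: "eval3 (X * Y) p y w = eval3 X p y w * eval3 Y p y w"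
  and eval3_1: "eval3 1 p y w = 1"
  by (simp_all add: eval2_def eval3_def)

lemma eval2_0 [simp]: "eval2 0 p y = 0" by (simp add: eval2_def)
lemma eval3_0 [simp]: "eval3 0 p y w = 0" by (simp add: eval3_def)

text \<open>Chain rule along the curve x \<mapsto> (x, y x): \<open>map_poly pderiv\<close> is the
  partial derivative in the inner variable, \<open>pderiv\<close> the one in the outer
  variable.\<close>

lemma has_real_derivative_eval2:
  assumes y: "(y has_real_derivative y') (at x)"
  shows "((\<lambda>x. eval2 X x (y x)) has_real_derivative
           eval2 (map_poly pderiv X) x (y x) + eval2 (pderiv X) x (y x) * y') (at x)"
proof (induction X)
  case (pCons a X)
  show ?case
    unfolding eval2_pCons
    by (rule derivative_eq_intros poly_DERIV pCons y refl)+
       (simp add: map_poly_pCons pderiv_pCons eval2_pCons eval2_add algebra_simps)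
qed simp

lemma has_real_derivative_eval3:
  assumes y: "(y has_real_derivative y') (at x)" and w: "(w has_real_derivative w') (at x)"
  shows "((\<lambda>x. eval3 X x (y x) (w x)) has_real_derivative
           eval3 (map_poly (map_poly pderiv) X) x (y x) (w x)
           + eval3 (map_poly pderiv X) x (y x) (w x) * y'
           + eval3 (pderiv X) x (y x) (w x) * w') (at x)"
proof (induction X)
  case (pCons a X)
  show ?case
    unfolding eval3_pCons
    by (rule derivative_eq_intros has_real_derivative_eval2 pCons y w refl)+
       (simp add: map_poly_pCons pderiv_pCons eval3_pCons eval3_add algebra_simps)
qed simp

section \<open>Growth of polynomials against a Gaussian exponent\<close>

lemma abs_le_exp_square:
  fixes c :: real assumes "c > 0"
  shows "\<exists>K. \<forall>y::real. \<bar>y\<bar> \<le> K * exp (c * y\<^sup>2)"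
proof (intro exI allI)
  fix y :: real
  have "0 \<le> (\<bar>y\<bar> - 1)\<^sup>2" by simp
  then have "\<bar>y\<bar> \<le> 1 + y\<^sup>2" by (simp add: power2_diff)
  also have "\<dots> \<le> (1 + 1/c) * (1 + c * y\<^sup>2)"
    using assms by (simp add: field_simps)
  also have "\<dots> \<le> (1 + 1/c) * exp (c * y\<^sup>2)"
    using assms by (intro mult_left_mono exp_ge_add_one_self) auto
  finally show "\<bar>y\<bar> \<le> (1 + 1/c) * exp (c * y\<^sup>2)" .
qed

text \<open>Each factor y costs half of the available exponent: c/2 absorbs y and c/2 is left for
  the remaining polynomial. Hence c stays arbitrary in the induction.\<close>

lemma eval2_bound:
  assumes "c > 0"
  shows "\<exists>K. \<forall>p\<in>{0..1}. \<forall>y. \<bar>eval2 X p y\<bar> \<le> K * exp (c * y\<^sup>2)"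
  using assms
proof (induction X arbitrary: c)
  case 0
  show ?case by (intro exI[of _ 0]) auto
next
  case (pCons a X)
  have "compact (poly a ` {0..1})"
    by (intro compact_continuous_image continuous_intros) auto
  then obtain A where A: "\<And>p. p \<in> {0..1} \<Longrightarrow> \<bar>poly a p\<bar> \<le> A"
    by (metis (no_types, lifting) bounded_iff compact_imp_bounded image_eqI real_norm_def)
  obtain L where L: "\<And>y. \<bar>y\<bar> \<le> L * exp (c/2 * y\<^sup>2)"
    using abs_le_exp_square[of "c/2"] pCons.prems by auto
  obtain K where K: "\<And>p y. p \<in> {0..1} \<Longrightarrow> \<bar>eval2 X p y\<bar> \<le> K * exp (c/2 * y\<^sup>2)"
    using pCons.IH[of "c/2"] pCons.prems by (meson half_gt_zero)
  have "\<bar>eval2 (pCons a X) p y\<bar> \<le> (A + L * K) * exp (c * y\<^sup>2)" if p: "p \<in> {0..1}" for p y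
  proof -
    have "\<bar>eval2 (pCons a X) p y\<bar> \<le> \<bar>poly a p\<bar> + \<bar>y\<bar> * \<bar>eval2 X p y\<bar>"
      by (simp add: eval2_pCons abs_mult[symmetric])
    also have "\<bar>y\<bar> * \<bar>eval2 X p y\<bar> \<le> (L * exp (c/2 * y\<^sup>2)) * (K * exp (c/2 * y\<^sup>2))"
      using L[of y] by (intro mult_mono L K p) auto
    also have "\<dots> = L * K * exp (c * y\<^sup>2)"
      by (simp add: exp_add[symmetric] field_simps)
    also have "\<bar>poly a p\<bar> \<le> A * exp (c * y\<^sup>2)"
    proof -
      have "A * 1 \<le> A * exp (c * y\<^sup>2)"
        using A[OF p] pCons.prems by (intro mult_left_mono) auto
      with A[OF p] show ?thesis by simp
    qed
    finally show ?thesis by (simp add: algebra_simps)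
  qed
  then show ?case by blast
qed

text \<open>Since w lies in [0, 1], a further factor w costs nothing and c can stay fixed. Strict
  positivity of K is wanted because the final comparison divides by it.\<close>

lemma eval3_bound:
  assumes "c > 0"
  shows "\<exists>K>0. \<forall>p\<in>{0..1}. \<forall>w\<in>{0..1}. \<forall>y. \<bar>eval3 X p y w\<bar> \<le> K * exp (c * y\<^sup>2)"
proof (induction X)
  case 0
  show ?case by (intro exI[of _ 1]) auto
next
  case (pCons a X)
  obtain A where A: "\<And>p y. p \<in> {0..1} \<Longrightarrow> \<bar>eval2 a p y\<bar> \<le> A * exp (c * y\<^sup>2)"
    using eval2_bound[OF assms] by blast
  obtain K where K: "K > 0"
    "\<And>p w y. p \<in> {0..1} \<Longrightarrow> w \<in> {0..1} \<Longrightarrow> \<bar>eval3 X p y w\<bar> \<le> K * exp (c * y\<^sup>2)"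
    using pCons.IH by blast
  have "A \<ge> 0" using A[of 0 0] by auto
  have "\<bar>eval3 (pCons a X) p y w\<bar> \<le> (A + K) * exp (c * y\<^sup>2)"
    if p: "p \<in> {0..1}" and w: "w \<in> {0..1}" for p y w
  proof -
    have "\<bar>eval3 (pCons a X) p y w\<bar> \<le> \<bar>eval2 a p y\<bar> + w * \<bar>eval3 X p y w\<bar>"
      using w by (auto simp add: eval3_pCons abs_mult intro: order_trans[OF abs_triangle_ineq])
    also have "w * \<bar>eval3 X p y w\<bar> \<le> 1 * \<bar>eval3 X p y w\<bar>"
      using w by (intro mult_right_mono) auto
    finally show ?thesis using A[OF p, of y] K(2)[OF p w, of y] by (simp add: algebra_simps)
  qed
  moreover have "A + K > 0" using K \<open>A \<ge> 0\<close> by simp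
  ultimately show ?case by blast
qed

text \<open>A value of type \<open>real poly poly poly\<close> is read as a polynomial in \<open>p\<close> (innermost), \<open>y\<close> and
  \<open>w = 1 / sqrt V\<close> (outermost); \<open>dvar\<close> and \<open>uvar\<close> stand for \<open>q - p\<close> and \<open>p q\<close>.\<close>

definition dvar :: "real poly poly poly" where "dvar = [:[:[:1, -2:]:]:]"
definition uvar :: "real poly poly poly" where "uvar = [:[:[:0, 1, -1:]:]:]"
definition yvar :: "real poly poly poly" where "yvar = [:[:0, 1:]:]"
definition wvar :: "real poly poly poly" where "wvar = [:0, 1:]"
definition half :: "real poly poly poly" where "half = [:[:[:1/2:]:]:]"

lemma eval3_vars:
  "eval3 dvar p y w = 1 - 2 * p" "eval3 uvar p y w = p * (1 - p)"
  "eval3 yvar p y w = y" "eval3 wvar p y w = w" "eval3 half p y w = 1/2"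
  by (simp_all add: dvar_def uvar_def yvar_def wvar_def half_def eval3_pCons eval2_pCons one_pCons
      algebra_simps)

text \<open>The derivation \<open>w p q d/dp\<close> along the curve \<open>p \<mapsto> (p, y, w)\<close> with \<open>n\<close> and \<open>j\<close> fixed; the factor
  \<open>w\<close> makes it preserve polynomials, because \<open>p q y' = - (1/w + y (q - p)/2)\<close>.\<close>

definition delta :: "real poly poly poly \<Rightarrow> real poly poly poly" where
  "delta X = wvar * uvar * map_poly (map_poly pderiv) X
             - (1 + half * dvar * yvar * wvar) * map_poly pderiv X
             - half * dvar * wvar * wvar * pderiv X"

section \<open>The expansion and its residual as polynomials\<close>

text \<open>P1 w + P2 w^2 + P3 w^3 + P4 w^4 with q = 1 - p multiplied out;
  \<open>eval3_edgeworth_poly\<close> confirms the agreement with the stated P1, ..., P4.\<close>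

definition edgeworth_poly :: "real poly poly poly" where
  "edgeworth_poly = [:0,
    [:[:1/6, -1/3:], 0, [:-1/6, 1/3:]:],
    [:0, [:-1/24, 1/12, -1/12:], 0, [:7/72, -11/36, 11/36:], 0, [:-1/72, 1/18, -1/18:]:],
    [:[:41/2160, -7/180, 1/360, -1/540:], 0, [:43/2160, -11/180, 23/360, -23/540:], 0,
      [:-8/135, 29/120, -133/360, 133/540:], 0, [:19/1296, -2/27, 29/216, -29/324:], 0,
      [:-1/1296, 1/216, -1/108, 1/162:]:],
    [:0, [:-53/1920, 23/288, -11/144, -1/144, 1/288:], 0,
      [:-151/17280, 31/864, -1/16, 23/432, -23/864:], 0,
      [:137/3456, -433/2160, 583/1440, -883/2160, 883/4320:], 0,
      [:-73/5760, 331/4320, -397/2160, 463/2160, -463/4320:], 0,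
      [:37/31104, -65/7776, 59/2592, -7/243, 7/486:], 0,
      [:-1/31104, 1/3888, -1/1296, 1/972, -1/1944:]:]:]"

text \<open>This is w p q F' / \<phi>(y) for F = \<Phi>(y) + \<phi>(y) Q. The product contributes
  because w p q y' = - (1 + (q - p) y w / 2), while \<phi>' = - y \<phi> turns the coefficient 1
  into 1 - y Q.\<close>

definition edgeworth_poly' :: "real poly poly poly" where
  "edgeworth_poly' = delta edgeworth_poly
     - (1 + half * dvar * yvar * wvar) * (1 - yvar * edgeworth_poly)"

text \<open>\<open>(p q w)\<^sup>2 (F'' - drift F') = \<phi>(y) residual_poly\<close> for the expansion \<open>F\<close>.\<close>

definition residual_poly :: "real poly poly poly" where
  "residual_poly = delta edgeworth_poly' + half * dvar * wvar * yvar * yvar * edgeworth_poly'"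

text \<open>The only place where the particular coefficients of P1, ..., P4 matter for the error:
  they cancel the residual up to w^4. Normalising the coefficient list shows its first five entries
  to be 0.\<close>

lemma wvar_power5_dvd_residual_poly: "wvar ^ 5 dvd residual_poly"
proof -
  note Qt = edgeworth_poly'_def[unfolded delta_def edgeworth_poly_def dvar_def uvar_def yvar_def wvar_def half_def,
      simplified map_poly_pCons pderiv_pCons one_pCons, simplified]
  have "\<exists>R. residual_poly = pCons 0 (pCons 0 (pCons 0 (pCons 0 (pCons 0 R))))"
    unfolding residual_poly_def Qt delta_def dvar_def uvar_def yvar_def wvar_def half_def
    by (simp add: map_poly_pCons pderiv_pCons one_pCons)
  then obtain R where "residual_poly = pCons 0 (pCons 0 (pCons 0 (pCons 0 (pCons 0 R))))" ..
  then have "residual_poly = wvar ^ 5 * R"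
    by (simp add: wvar_def numeral_eq_Suc)
  then show ?thesis by (rule dvdI)
qed

section \<open>Differential equations in the success probability\<close>

definition sdev :: "real \<Rightarrow> real \<Rightarrow> real" where
  "sdev n p = sqrt (n * p * (1 - p))"

definition ystd :: "real \<Rightarrow> real \<Rightarrow> real \<Rightarrow> real" where
  "ystd n a p = (a - n * p) / sdev n p"

lemma sdev_pos: "n > 0 \<Longrightarrow> 0 < p \<Longrightarrow> p < 1 \<Longrightarrow> sdev n p > 0"
  by (simp add: sdev_def)

lemma sdev_square: "n > 0 \<Longrightarrow> 0 < p \<Longrightarrow> p < 1 \<Longrightarrow> (sdev n p)\<^sup>2 = n * (p * (1 - p))"
  by (simp add: sdev_def)

text \<open>The derivative is expressed through \<open>sdev n p\<close> and p q, using n = (sdev n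
  p)^2 / (p q), so that n itself disappears from all later identities.\<close>

lemma has_real_derivative_sdev:
  assumes "n > 0" "0 < p" "p < 1"
  shows "(sdev n has_real_derivative sdev n p * (1 - 2 * p) / (2 * (p * (1 - p)))) (at p)"
proof -
  have V: "n * p * (1 - p) > 0" using assms by simp
  have s: "sdev n p > 0" "sdev n p * sdev n p = n * (p * (1 - p))"
    using sdev_pos sdev_square assms by (auto simp: power2_eq_square)
  have "(sdev n has_real_derivative n * (1 - 2 * p) / (2 * sdev n p)) (at p)"
    unfolding sdev_def[abs_def] using V
    by (auto intro!: derivative_eq_intros simp: field_simps)
  also have "n * (1 - 2 * p) / (2 * sdev n p) = sdev n p * (1 - 2 * p) / (2 * (p * (1 - p)))"
  proof -
    have "p * (1 - p) > 0" using assms by simp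
    then have n: "n = sdev n p * sdev n p / (p * (1 - p))" 
      unfolding s(2) using assms by simp
    show ?thesis
      by (subst n) (use s(1) in simp)
  qed
  finally show ?thesis .
qed

lemma has_real_derivative_ystd:
  assumes "n > 0" "0 < p" "p < 1"
  shows "(ystd n a has_real_derivative
           - (sdev n p + ystd n a p * (1 - 2 * p) / 2) / (p * (1 - p))) (at p)"
proof -
  define s u where "s = sdev n p" and "u = p * (1 - p)"
  have s: "s > 0" "s * s = n * u"
    using sdev_pos sdev_square assms by (auto simp: power2_eq_square s_def u_def)
  have u: "u > 0" using assms by (simp add: u_def)
  have n: "n = s * s / u" using s u by simp
  have "(ystd n a has_real_derivative
          (- n * s - (a - n * p) * (s * (1 - 2 * p) / (2 * u))) / (s * s)) (at p)"
    unfolding ystd_def[abs_def] s_def u_def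
    by (rule derivative_eq_intros has_real_derivative_sdev assms refl
          | use s in \<open>simp add: s_def\<close>)+
  also have "(- n * s - (a - n * p) * (s * (1 - 2 * p) / (2 * u))) / (s * s)
      = - n / s - (a - n * p) / s * (1 - 2 * p) / (2 * u)"
    using s(1) u by (simp add: field_simps)
  also have "- n / s = - s / u" by (subst n) (use s(1) in simp)
  also have "- s / u - (a - n * p) / s * (1 - 2 * p) / (2 * u)
      = - (s + (a - n * p) / s * (1 - 2 * p) / 2) / u"
    using s(1) u by (simp add: field_simps)
  finally show ?thesis by (simp only: ystd_def[abs_def] s_def u_def)
qed

lemma has_real_derivative_inverse_sdev:
  assumes "n > 0" "0 < p" "p < 1"
  shows "((\<lambda>p. 1 / sdev n p) has_real_derivative
           - (1 / sdev n p) * (1 - 2 * p) / (2 * (p * (1 - p)))) (at p)"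
  using sdev_pos[OF assms] assms
  by (auto intro!: derivative_eq_intros has_real_derivative_sdev simp: divide_simps)

section \<open>Derivatives of the normal density and distribution function\<close>

lemma has_real_derivative_std_normal_density:
  "(std_normal_density has_real_derivative - x * std_normal_density x) (at x)"
  unfolding std_normal_density_def[abs_def]
  by (rule DERIV_cmult derivative_eq_intros refl | simp)+

text \<open>Cutting the improper integral at x - 1 leaves a constant and an integral over a compact
  interval, to which the fundamental theorem of calculus applies. The cut is valid on the open set t
  > x - 1 around x.\<close>

lemma has_real_derivative_Phi: "(Phi has_real_derivative std_normal_density x) (at x)"
proof -
  have cont: "continuous_on UNIV std_normal_density"
    by (intro continuous_at_imp_continuous_on ballI
        DERIV_isCont[OF has_real_derivative_std_normal_density])
  have eq: "Phi t = Phi (x - 1) + integral {x - 1..t} std_normal_density" if "t > x - 1" for t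
  proof -
    have int: "set_integrable lborel A std_normal_density" if "A \<in> sets lborel" for A
      using integrable_normal_density[of 1 0] that unfolding set_integrable_def
      by (intro integrable_mult_indicator) auto
    have "{..t} = {..x-1} \<union> {x-1<..t}" using that by auto
    then have "Phi t = Phi (x - 1) + (LINT s:{x-1<..t}|lborel. std_normal_density s)"
      unfolding Phi_def by (subst set_integral_Un[symmetric]) (auto intro: int)
    also have "(LINT s:{x-1<..t}|lborel. std_normal_density s) =
               (LINT s:{x-1..t}|lborel. std_normal_density s)"
      using that
      by (metis interval_integral_Icc interval_integral_Ioc less_imp_le)
    also have "\<dots> = integral {x-1..t} std_normal_density"
      by (rule set_borel_integral_eq_integral) (auto intro: int)
    finally show ?thesis .
  qed
  have "((\<lambda>t. Phi (x - 1) + integral {x - 1..t} std_normal_density) has_real_derivative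
          std_normal_density x) (at x within {x-1..x+1})"
    by (rule DERIV_cong[OF DERIV_add[OF DERIV_const
          integral_has_real_derivative[OF continuous_on_subset[OF cont]]]]) auto
  then have "((\<lambda>t. Phi (x - 1) + integral {x - 1..t} std_normal_density) has_real_derivative
          std_normal_density x) (at x)"
    by (subst (asm) at_within_Icc_at) auto
  then show ?thesis
    by (rule has_field_derivative_transform_within_open[of _ _ _ "{x-1<..}"])
       (auto simp: eq)
qed

text \<open>The logarithmic derivative in \<open>p\<close> of \<open>p ^ j * q ^ (n - 1 - j)\<close>, where \<open>a = j + 1/2\<close>.\<close>

definition drift :: "real \<Rightarrow> real \<Rightarrow> real \<Rightarrow> real" where
  "drift n a p = (a - n * p - (1 - 2 * p) / 2) / (p * (1 - p))"

lemma eval3_delta: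
  "eval3 (delta X) p y w = w * (p * (1 - p)) * eval3 (map_poly (map_poly pderiv) X) p y w
     - (1 + (1 - 2 * p) * y * w / 2) * eval3 (map_poly pderiv X) p y w
     - (1 - 2 * p) * w * w / 2 * eval3 (pderiv X) p y w"
  by (simp add: delta_def eval3_add eval3_diff eval3_mult eval3_vars eval3_1)

lemma has_real_derivative_eval3_delta:
  assumes "n > 0" "0 < p" "p < 1"
  shows "((\<lambda>p. eval3 X p (ystd n a p) (1 / sdev n p)) has_real_derivative
           sdev n p / (p * (1 - p)) * eval3 (delta X) p (ystd n a p) (1 / sdev n p)) (at p)"
proof -
  have s: "sdev n p > 0" by (rule sdev_pos) fact+
  have u: "p * (1 - p) > 0" using assms by simp
  have *: "A + B * (- (s + y * d / 2) / u) + C * (- (1 / s) * d / (2 * u)) =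
     s / u * (1 / s * u * A - (1 + d * y * (1 / s) / 2) * B - d * (1/s) * (1/s) / 2 * C)"
    if "s > 0" "u > 0" for A B C s u d y :: real
    using that by (simp add: field_simps)
  show ?thesis
    using has_real_derivative_eval3[OF has_real_derivative_ystd[OF assms]
        has_real_derivative_inverse_sdev[OF assms], of X a]
    unfolding eval3_delta *[OF s u] .
qed

section \<open>The differential equation for the expansion\<close>

definition edgeworth :: "real \<Rightarrow> real \<Rightarrow> real \<Rightarrow> real" where
  "edgeworth n a p = Phi (ystd n a p)
     + std_normal_density (ystd n a p) * eval3 edgeworth_poly p (ystd n a p) (1 / sdev n p)"

definition edgeworth' :: "real \<Rightarrow> real \<Rightarrow> real \<Rightarrow> real" where
  "edgeworth' n a p = std_normal_density (ystd n a p) * sdev n p / (p * (1 - p))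
     * eval3 edgeworth_poly' p (ystd n a p) (1 / sdev n p)"

lemma has_real_derivative_edgeworth:
  assumes "n > 0" "0 < p" "p < 1"
  shows "(edgeworth n a has_real_derivative edgeworth' n a p) (at p)"
proof -
  define y s u d where "y = ystd n a p" and "s = sdev n p" and "u = p * (1 - p)" and "d = 1 - 2 * p"
  have s: "s > 0" using sdev_pos assms by (simp add: s_def)
  have u: "u > 0" using assms by (simp add: u_def)
  have "(edgeworth n a has_real_derivative
      std_normal_density y * (- (s + y * d / 2) / u)
      + ((- y * std_normal_density y) * (- (s + y * d / 2) / u) * eval3 edgeworth_poly p y (1/s)
         + (s / u * eval3 (delta edgeworth_poly) p y (1/s)) * std_normal_density y)) (at p)"
      (is "(_ has_real_derivative ?D) _")
    unfolding edgeworth_def[abs_def] y_def s_def u_def d_def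
    by (intro DERIV_add DERIV_mult DERIV_chain2[OF has_real_derivative_Phi]
        DERIV_chain2[OF has_real_derivative_std_normal_density] has_real_derivative_ystd
        has_real_derivative_eval3_delta assms)
  also have "?D = edgeworth' n a p"
  proof -
    have "g * (- (s + y * d / 2) / u) + ((- y * g) * (- (s + y * d / 2) / u) * Q + (s / u * D) * g)
        = g * s / u * (D - (1 + 1/2 * d * y * (1/s)) * (1 - y * Q))" for g Q D
      using s u by (simp add: field_simps)
    then show ?thesis
      unfolding edgeworth'_def edgeworth_poly'_def eval3_diff eval3_mult eval3_add eval3_1 eval3_vars
        y_def[symmetric] s_def[symmetric] u_def[symmetric] d_def[symmetric] by blast
  qed
  finally show ?thesis .
qed

text \<open>With s = \<open>sdev n p\<close>, the prefactor \<phi>(y) s / (p q) of F' has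
  logarithmic derivative \<open>drift\<close> + (q - p) y^2 / (2 p q). The surplus over the drift is
  the second summand of \<open>residual_poly\<close>.\<close>

lemma has_real_derivative_edgeworth':
  assumes "n > 0" "0 < p" "p < 1"
  shows "(edgeworth' n a has_real_derivative
           drift n a p * edgeworth' n a p
           + std_normal_density (ystd n a p) * (sdev n p)\<^sup>2
             * eval3 residual_poly p (ystd n a p) (1 / sdev n p) / (p * (1 - p))\<^sup>2) (at p)"
proof -
  define y s u d where "y = ystd n a p" and "s = sdev n p" and "u = p * (1 - p)" and "d = 1 - 2 * p"
  have s: "s > 0" using sdev_pos assms by (simp add: s_def)
  have u: "u > 0" using assms by (simp add: u_def)
  have a: "a - n * p = y * s" using s by (simp add: y_def s_def ystd_def)
  have su: "((\<lambda>p. sdev n p / (p * (1 - p))) has_real_derivative - (s * d / (2 * u\<^sup>2))) (at p)"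
  proof -
    have "((\<lambda>p. p * (1 - p)) has_real_derivative d) (at p)"
      by (auto intro!: derivative_eq_intros simp: d_def)
    then have "((\<lambda>p. sdev n p / (p * (1 - p))) has_real_derivative
        (s * d / (2 * u) * u - s * d) / (u * u)) (at p)"
      unfolding s_def u_def d_def
      by (rule DERIV_divide[OF has_real_derivative_sdev[OF assms]]) (use assms in auto)
    then show ?thesis using u by (simp add: field_simps power2_eq_square)
  qed
  have "((\<lambda>p. std_normal_density (ystd n a p) * (sdev n p / (p * (1 - p)))
       * eval3 edgeworth_poly' p (ystd n a p) (1 / sdev n p)) has_real_derivative
      ((- y * std_normal_density y) * (- (s + y * d / 2) / u) * (s / u)
        + (- (s * d / (2 * u\<^sup>2))) * std_normal_density y) * eval3 edgeworth_poly' p y (1/s)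
         + (s / u * eval3 (delta edgeworth_poly') p y (1/s)) * (std_normal_density y * (s / u))) (at p)"
      (is "(_ has_real_derivative ?D) _")
    unfolding  y_def s_def u_def d_def
    by (intro DERIV_mult su[unfolded y_def s_def u_def d_def]
        DERIV_chain2[OF has_real_derivative_std_normal_density] has_real_derivative_ystd
        has_real_derivative_eval3_delta assms)
  also have "?D = drift n a p * edgeworth' n a p
       + std_normal_density y * s\<^sup>2 * eval3 residual_poly p y (1 / s) / u\<^sup>2"
  proof -
    have "((- y * g) * (- (s + y * d / 2) / u) * (s / u) + (- (s * d / (2 * u\<^sup>2))) * g) * Q
          + (s / u * D) * (g * (s / u))
        = (y * s - d / 2) / u * (g * s / u * Q)
          + g * s\<^sup>2 * (D + 1/2 * d * (1/s) * y * y * Q) / u\<^sup>2" for g Q D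
      using s u by (simp add: field_simps power2_eq_square)
    then show ?thesis
      unfolding edgeworth'_def residual_poly_def eval3_diff eval3_mult eval3_add eval3_1 eval3_vars drift_def a
        y_def[symmetric] s_def[symmetric] u_def[symmetric] d_def[symmetric] by blast
  qed
  finally show ?thesis by (simp add: edgeworth'_def[abs_def] y_def s_def u_def)
qed

section \<open>The barrier function\<close>

text \<open>The exponent is half that of the normal density: the remaining factor exp (- y^2 / 4) of
  the density absorbs the polynomial growth of the residual in y.\<close>

definition barrier :: "real \<Rightarrow> real \<Rightarrow> real \<Rightarrow> real" where
  "barrier n a p = exp (- (ystd n a p)\<^sup>2 / 4)"

definition barrier' :: "real \<Rightarrow> real \<Rightarrow> real \<Rightarrow> real" where
  "barrier' n a p =
     barrier n a p * ystd n a p / 2 * (sdev n p + ystd n a p * (1 - 2 * p) / 2) / (p * (1 - p))"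

lemma has_real_derivative_barrier:
  assumes "n > 0" "0 < p" "p < 1"
  shows "(barrier n a has_real_derivative barrier' n a p) (at p)"
proof -
  have "((\<lambda>p. - (ystd n a p)\<^sup>2 / 4) has_real_derivative
      ystd n a p / 2 * (sdev n p + ystd n a p * (1 - 2 * p) / 2) / (p * (1 - p))) (at p)"
    by (rule DERIV_cong[OF DERIV_cdivide[OF DERIV_minus[OF
          DERIV_power[OF has_real_derivative_ystd[OF assms]]]]])
       (use assms in \<open>simp add: field_simps\<close>)
  from DERIV_fun_exp[OF this] show ?thesis
    unfolding barrier'_def barrier_def[abs_def]
    by (simp only: times_divide_eq_right times_divide_eq_left mult.assoc)
qed

text \<open>Here m = - p q y'. When m is close to s the bracket is governed by - s^2 - y^2 s^2 / 2,
  which is why it can be made negative in \<open>barrier_residual_bound\<close>.\<close>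

lemma has_real_derivative_barrier':
  fixes n a p
  defines "y \<equiv> ystd n a p" and "s \<equiv> sdev n p" and "u \<equiv> p * (1 - p)" and "d \<equiv> 1 - 2 * p"
  defines "m \<equiv> s + y * d / 2"
  assumes "n > 0" "0 < p" "p < 1"
  shows "(barrier' n a has_real_derivative
           drift n a p * barrier' n a p
           + barrier n a p / 2 * (- m\<^sup>2 + y\<^sup>2 * m * (m / 2 - s) - y * s * d / 2 - y\<^sup>2 * (d\<^sup>2 / 2 + u))
             / u\<^sup>2) (at p)"
proof -
  have s: "s > 0" using sdev_pos assms by (simp add: s_def)
  have u: "u > 0" using assms by (simp add: u_def)
  have a: "a - n * p = y * s" using s by (simp add: y_def s_def ystd_def)
  have "((\<lambda>p. barrier n a p * ystd n a p / 2 * (sdev n p + ystd n a p * (1 - 2 * p) / 2) / (p * (1 - p)))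
     has_real_derivative
      drift n a p * barrier' n a p
           + barrier n a p / 2 * (- m\<^sup>2 + y\<^sup>2 * m * (m / 2 - s) - y * s * d / 2 - y\<^sup>2 * (d\<^sup>2 / 2 + u))
             / u\<^sup>2) (at p)"
  proof -
    have "((\<lambda>p. p * (1 - p)) has_real_derivative d) (at p)"
      by (auto intro!: derivative_eq_intros simp: d_def)
    then have "((\<lambda>p. barrier n a p * ystd n a p / 2 * (sdev n p + ystd n a p * (1 - 2 * p) / 2)
        / (p * (1 - p))) has_real_derivative
      (((barrier' n a p * y + (- m / u) * barrier n a p) / 2 * m
          + (s * d / (2 * u) + ((- m / u) * d + (-2) * y) / 2) * (barrier n a p * y / 2)) * u
        - barrier n a p * y / 2 * m * d) / (u * u)) (at p)"
      unfolding y_def s_def u_def d_def m_def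
      by (intro DERIV_divide DERIV_mult DERIV_add DERIV_cdivide has_real_derivative_sdev
          has_real_derivative_ystd has_real_derivative_barrier assms)
         (use assms in \<open>auto intro!: derivative_eq_intros\<close>)
    also have "(((barrier' n a p * y + (- m / u) * barrier n a p) / 2 * m
          + (s * d / (2 * u) + ((- m / u) * d + (-2) * y) / 2) * (barrier n a p * y / 2)) * u
        - barrier n a p * y / 2 * m * d) / (u * u) =
      drift n a p * barrier' n a p
           + barrier n a p / 2 * (- m\<^sup>2 + y\<^sup>2 * m * (m / 2 - s) - y * s * d / 2 - y\<^sup>2 * (d\<^sup>2 / 2 + u))
             / u\<^sup>2"
    proof -
      have "(((B * y / 2 * m / u * y + (- m / u) * B) / 2 * m
            + (s * d / (2 * u) + ((- m / u) * d + (-2) * y) / 2) * (B * y / 2)) * u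
          - B * y / 2 * m * d) / (u * u)
        = (y * s - d / 2) / u * (B * y / 2 * m / u)
           + B / 2 * (- m\<^sup>2 + y\<^sup>2 * m * (m / 2 - s) - y * s * d / 2 - y\<^sup>2 * (d\<^sup>2 / 2 + u))
             / u\<^sup>2" for B
        using u unfolding m_def by (simp add: field_simps power2_eq_square)
      then show ?thesis
        unfolding barrier'_def drift_def a
          y_def[symmetric] s_def[symmetric] u_def[symmetric] d_def[symmetric] m_def[symmetric]
        by blast
    qed
    finally show ?thesis .
  qed
  then show ?thesis by (simp add: barrier'_def[abs_def])
qed

section \<open>The binomial distribution function in the success probability\<close>

definition binom_cdf :: "nat \<Rightarrow> nat \<Rightarrow> real \<Rightarrow> real" where
  "binom_cdf n j p = (\<Sum>k=0..j. real (n choose k) * p ^ k * (1 - p) ^ (n - k))"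

text \<open>For j = n the factor n - j vanishes, in accordance with a distribution function
  constantly 1; the truncated exponent is then harmless.\<close>

definition binom_cdf' :: "nat \<Rightarrow> nat \<Rightarrow> real \<Rightarrow> real" where
  "binom_cdf' n j p = - (real (n - j) * real (n choose j) * p ^ j * (1 - p) ^ (n - j - 1))"

text \<open>The sum of derivatives telescopes, because (j + 1) (n choose (j + 1)) = (n - j) (n
  choose j); only a part of the last term survives.\<close>

lemma has_real_derivative_binom_cdf:
  assumes "j \<le> n"
  shows "(binom_cdf n j has_real_derivative binom_cdf' n j p) (at p)"
  using assms
proof (induction j)
  case 0
  show ?case unfolding binom_cdf_def[abs_def] binom_cdf'_def
    by (auto intro!: derivative_eq_intros)
next
  case (Suc j)
  define k where "k = n - Suc j"
  have n: "n - j = Suc k" "n - Suc j = k" using Suc.prems by (auto simp: k_def)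
  have bin: "real (Suc j) * real (n choose Suc j) = real (Suc k) * real (n choose j)"
    using binomial_absorb_comp[of n j] binomial_absorption[of j "n - 1"] Suc.prems n
    by (metis One_nat_def Suc_le_D binomial_absorption diff_Suc_1 of_nat_mult)
  have eq: "binom_cdf n (Suc j) = (\<lambda>p. binom_cdf n j p
      + real (n choose Suc j) * p ^ Suc j * (1 - p) ^ (n - Suc j))"
    by (auto simp: binom_cdf_def)
  have "((\<lambda>p. binom_cdf n j p + real (n choose Suc j) * p ^ Suc j * (1 - p) ^ (n - Suc j))
     has_real_derivative binom_cdf' n j p
      + real (n choose Suc j) * (real (Suc j) * p ^ j * (1 - p) ^ k
         - p ^ Suc j * (real k * (1 - p) ^ (k - 1)))) (at p)"
    using Suc unfolding n
    by (auto intro!: derivative_eq_intros simp del: power_Suc) (simp add: algebra_simps)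
  also have "binom_cdf' n j p + real (n choose Suc j) * (real (Suc j) * p ^ j * (1 - p) ^ k
         - p ^ Suc j * (real k * (1 - p) ^ (k - 1))) = binom_cdf' n (Suc j) p
         + p ^ j * (1 - p) ^ k * (real (Suc j) * real (n choose Suc j) - real (Suc k) * real (n choose j))"
    unfolding binom_cdf'_def n by (simp add: algebra_simps)
  finally show ?case unfolding eq bin by simp
qed

lemma has_real_derivative_binom_cdf':
  assumes "j \<le> n" "0 < p" "p < 1"
  shows "(binom_cdf' n j has_real_derivative drift n (j + 1/2) p * binom_cdf' n j p) (at p)"
proof (cases "j = n")
  case True
  then show ?thesis by (simp add: binom_cdf'_def[abs_def])
next
  case False
  define k where "k = n - j - 1"
  have n: "real n = real j + real k + 1" using False assms by (simp add: k_def)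
  \<comment> \<open>For i = 0 both sides vanish, so the truncated exponent i - 1 does no
    harm.\<close>
  have pw: "real i * x ^ (i - 1) = real i / x * x ^ i" if "x > 0" for i and x :: real
    using that by (cases i) auto
  \<comment> \<open>Partial fractions: j (1 - p) - k p = j - (n - 1) p, which is a - n p - (1 - 2 p)
    / 2 for a = j + 1/2. This is where the continuity correction 1/2 enters.\<close>
  have drift: "drift n (j + 1/2) p = real j / p - real k / (1 - p)"
    using assms unfolding drift_def n by (simp add: divide_simps) (simp add: algebra_simps)
  have "(binom_cdf' n j has_real_derivative
     - (real (n - j) * real (n choose j) * ((real j * p ^ (j - 1)) * (1 - p) ^ k
        - p ^ j * (real k * (1 - p) ^ (k - 1))))) (at p)"
    unfolding binom_cdf'_def[abs_def] k_def[symmetric]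
    by (auto intro!: derivative_eq_intros simp: algebra_simps)
  also have "real j * p ^ (j - 1) = real j / p * p ^ j"
    using assms by (intro pw)
  also have "real k * (1 - p) ^ (k - 1) = real k / (1 - p) * (1 - p) ^ k"
    using assms by (intro pw) auto
  finally show ?thesis
    by (rule DERIV_cong)
       (simp only: binom_cdf'_def drift k_def[symmetric], simp add: algebra_simps)
qed

text \<open>At an interior maximum c the derivative f' vanishes, so its own derivative there is r c
  > 0. Then f' is positive just to the right of c and f exceeds f c, a contradiction.\<close>

lemma maximum_principle:
  fixes f f' k r :: "real \<Rightarrow> real"
  assumes f: "\<And>x. x \<in> {a..b} \<Longrightarrow> (f has_real_derivative f' x) (at x)"
    and f': "\<And>x. x \<in> {a..b} \<Longrightarrow> (f' has_real_derivative k x * f' x + r x) (at x)"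
    and r: "\<And>x. x \<in> {a..b} \<Longrightarrow> r x > 0"
    and x: "x \<in> {a..b}"
  shows "f x \<le> max (f a) (f b)"
proof -
  have "continuous_on {a..b} f"
    by (intro continuous_at_imp_continuous_on ballI DERIV_isCont[OF f])
  then obtain c where c: "c \<in> {a..b}" "\<And>z. z \<in> {a..b} \<Longrightarrow> f z \<le> f c"
    using continuous_attains_sup[of "{a..b}" f] x by auto
  have "c = a \<or> c = b"
  proof (rule ccontr)
    assume "\<not> ?thesis"
    then have c': "a < c" "c < b" using c by auto
    have 0: "f' c = 0"
      using c' by (intro DERIV_local_max[OF f[OF c(1)], of "min (c - a) (b - c)"])
        (auto intro!: c(2))
    then obtain e where e: "e > 0" "\<And>h. 0 < h \<Longrightarrow> h < e \<Longrightarrow> f' c < f' (c + h)"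
      using DERIV_pos_inc_right[OF f'[OF c(1)]] r[OF c(1)] by auto
    define h where "h = min e (b - c) / 2"
    have h: "h > 0" "h < e" "c + h < b" using e(1) c' by (auto simp: h_def min_def field_simps)
    obtain z where z: "c < z" "z < c + h" "f (c + h) - f c = (c + h - c) * f' z"
      using MVT2[of c "c + h" f f'] f h c' by auto
    have "f' z > 0" using e(2)[of "z - c"] z h 0 by auto
    then have "f (c + h) > f c" using z(3) mult_pos_pos[OF h(1)] by fastforce
    then show False using c(2)[of "c + h"] h c' by auto
  qed
  then show ?thesis using c(2)[OF x] by auto
qed

section \<open>Tail estimates\<close>

text \<open>Markov's inequality for the sixth moment, which is 6! / (2^3 3!) = 15. The sixth power
  suffices: y^2 of order n gives n^(-3).\<close>

lemma
  shows Phi_nonneg: "Phi y \<ge> 0" and Phi_le_1: "Phi y \<le> 1"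
    and Phi_lower_tail: "y < 0 \<Longrightarrow> Phi y \<le> 15 / y ^ 6"
    and Phi_upper_tail: "y > 0 \<Longrightarrow> 1 - Phi y \<le> 15 / y ^ 6"
proof -
  have int: "integrable lborel (\<lambda>t. indicator A t * std_normal_density t)"
    if "A \<in> sets borel" for A
    using integrable_mult_indicator[of A lborel std_normal_density] that by simp
  have mom: "has_bochner_integral lborel (\<lambda>t. std_normal_density t * t ^ 6 / y ^ 6) (15 / y ^ 6)"
    using has_bochner_integral_divide_zero[OF std_normal_moment_even[of 3], of "y ^ 6"]
    by (simp add: fact_numeral)
  have tail: "(LINT t|lborel. indicator A t * std_normal_density t) \<le> 15 / y ^ 6"
    if A: "A \<in> sets borel" and ge: "\<And>t. t \<in> A \<Longrightarrow> \<bar>y\<bar> \<le> \<bar>t\<bar>" and "y \<noteq> 0" for A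
  proof -
    have "(LINT t|lborel. indicator A t * std_normal_density t)
        \<le> (LINT t|lborel. std_normal_density t * t ^ 6 / y ^ 6)"
    proof (rule integral_mono[OF int[OF A]])
      fix t :: real
      show "indicator A t * std_normal_density t \<le> std_normal_density t * t ^ 6 / y ^ 6"
      proof (cases "t \<in> A")
        case True
        have y6: "y ^ 6 > 0" using \<open>y \<noteq> 0\<close> by (simp add: zero_less_power_eq)
        have "\<bar>y\<bar> ^ 6 \<le> \<bar>t\<bar> ^ 6" using ge[OF True] by (intro power_mono) auto
        then have "1 \<le> t ^ 6 / y ^ 6" using y6 by (simp add: power_even_abs)
        then have "std_normal_density t * 1 \<le> std_normal_density t * (t ^ 6 / y ^ 6)"
          by (intro mult_left_mono) auto
        with True show ?thesis by simp
      qed (simp add: zero_le_even_power)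
    qed (use mom in \<open>auto simp: has_bochner_integral_iff\<close>)
    also have "\<dots> = 15 / y ^ 6" using mom by (simp add: has_bochner_integral_iff)
    finally show ?thesis .
  qed
  have Phi: "Phi y = (LINT t|lborel. indicator {..y} t * std_normal_density t)"
    by (simp add: Phi_def set_lebesgue_integral_def)
  have "1 = (LINT t|lborel. std_normal_density t)" by simp
  also have "\<dots> = (LINT t|lborel. indicator {..y} t * std_normal_density t
                            + indicator {y<..} t * std_normal_density t)"
    by (intro Bochner_Integration.integral_cong) (auto simp: indicator_def)
  also have "\<dots> = Phi y + (LINT t|lborel. indicator {y<..} t * std_normal_density t)"
    unfolding Phi by (intro Bochner_Integration.integral_add int) auto
  finally have Phi': "1 - Phi y = (LINT t|lborel. indicator {y<..} t * std_normal_density t)"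
    by simp
  show "Phi y \<ge> 0" unfolding Phi by (intro Bochner_Integration.integral_nonneg) auto
  have "1 - Phi y \<ge> 0" unfolding Phi' by (intro Bochner_Integration.integral_nonneg) auto
  then show "Phi y \<le> 1" by simp
  show "Phi y \<le> 15 / y ^ 6" if "y < 0"
    unfolding Phi by (rule tail) (use that in auto)
  show "1 - Phi y \<le> 15 / y ^ 6" if "y > 0"
    unfolding Phi' by (rule tail) (use that in auto)
qed

lemma binom_cdf_eq_prob:
  assumes "p \<in> {0..1}"
  shows "binom_cdf n j p = measure_pmf.prob (binomial_pmf n p) {..j}"
  using assms by (simp add: binom_cdf_def measure_measure_pmf_finite atLeast0AtMost)

text \<open>Hoeffding's inequality for a deviation of e n from the mean.\<close>

lemma binom_cdf_lower_tail:
  assumes p: "p \<in> {0..1}" and n: "n > 0" and e: "e \<ge> 0" and j: "real j + 1/2 \<le> n * p - e * n"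
  shows "binom_cdf n j p \<le> exp (- 2 * e\<^sup>2 * n)"
proof -
  interpret binomial_distribution n p by unfold_locales fact
  have "binom_cdf n j p \<le> measure_pmf.prob (binomial_pmf n p) {x. real x \<le> n * p - e * n}"
    unfolding binom_cdf_eq_prob[OF p] using j by (intro measure_pmf.finite_measure_mono) auto
  also have "\<dots> \<le> exp (- 2 * (e * n)\<^sup>2 / n)"
    using e n by (intro prob_le) auto
  also have "- 2 * (e * n)\<^sup>2 / n = - 2 * e\<^sup>2 * n"
    using n by (simp add: power2_eq_square)
  finally show ?thesis .
qed

lemma binom_cdf_upper_tail:
  assumes p: "p \<in> {0..1}" and n: "n > 0" and e: "e \<ge> 0" and j: "real j + 1/2 \<ge> n * p + e * n"
  shows "1 - binom_cdf n j p \<le> exp (- 2 * e\<^sup>2 * n)"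
proof -
  interpret binomial_distribution n p by unfold_locales fact
  have "1 - binom_cdf n j p = measure_pmf.prob (binomial_pmf n p) (UNIV - {..j})"
    unfolding binom_cdf_eq_prob[OF p] using measure_pmf.prob_compl[of "{..j}" "binomial_pmf n p"]
    by simp
  \<comment> \<open>Every value outside \<open>{..j}\<close> is at least j + 1, hence above the
    half-integer threshold j + 1/2.\<close>
  also have "\<dots> \<le> measure_pmf.prob (binomial_pmf n p) {x. real x \<ge> n * p + e * n}"
    using j by (intro measure_pmf.finite_measure_mono) auto
  also have "\<dots> \<le> exp (- 2 * (e * n)\<^sup>2 / n)"
    using e n by (intro prob_ge) auto
  also have "- 2 * (e * n)\<^sup>2 / n = - 2 * e\<^sup>2 * n"
    using n by (simp add: power2_eq_square)
  finally show ?thesis .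
qed

lemma exp_minus_le_inverse_cube:
  fixes x :: real assumes "x > 0"
  shows "exp (- x) \<le> 27 / x ^ 3"
proof -
  have "x ^ 3 / 27 = (x / 3) ^ 3" by (simp add: power_divide)
  also have "\<dots> \<le> (1 + x / 3) ^ 3" using assms by (intro power_mono) auto
  also have "\<dots> \<le> exp x" using exp_ge_one_plus_x_over_n_power_n[of 3 x] assms by simp
  finally show ?thesis using assms by (simp add: exp_minus field_simps)
qed

lemma abs_std_normal_density_mult_le:
  assumes "\<bar>X\<bar> \<le> K * exp (1/4 * y\<^sup>2)"
  shows "\<bar>std_normal_density y * X\<bar> \<le> K * exp (- y\<^sup>2 / 4)"
proof -
  have "1 \<le> sqrt (2 * pi)" using pi_gt3 by simp
  then have "\<bar>std_normal_density y\<bar> \<le> exp (- y\<^sup>2 / 2)"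
    by (simp add: std_normal_density_def divide_simps)
  then have "\<bar>std_normal_density y * X\<bar> \<le> exp (- y\<^sup>2 / 2) * (K * exp (1/4 * y\<^sup>2))"
    unfolding abs_mult using assms by (intro mult_mono) auto
  also have "\<dots> = K * exp (- y\<^sup>2 / 4)"
    by (simp add: exp_add[symmetric])
  finally show ?thesis .
qed

text \<open>Far from the mean, the binomial distribution function and \<Phi>(y) are both near 0 or
  both near 1, and the correction is exponentially small. The condition on \<open>sdev\<close> puts
  w into [0, 1].\<close>

lemma binom_cdf_edgeworth_far:
  assumes e: "e > 0"
  shows "\<exists>C>0. \<forall>n j p. n > 0 \<longrightarrow> 0 < p \<longrightarrow> p < 1 \<longrightarrow> sdev (real n) p \<ge> 1 \<longrightarrow>
           \<bar>real j + 1/2 - n * p\<bar> \<ge> e * n \<longrightarrow>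
           \<bar>binom_cdf n j p - edgeworth n (j + 1/2) p\<bar> \<le> C / real n ^ 3"
proof -
  obtain K where K: "K > 0" "\<And>p w y. p \<in> {0..1} \<Longrightarrow> w \<in> {0..1} \<Longrightarrow>
      \<bar>eval3 edgeworth_poly p y w\<bar> \<le> K * exp (1/4 * y\<^sup>2)"
    using eval3_bound[of "1/4" edgeworth_poly] by auto
  \<comment> \<open>The summands account for the Hoeffding bound, the normal tail and the correction
    terms, in this order.\<close>
  define C where "C = 27 / (2 * e\<^sup>2) ^ 3 + 15 / (4 * e\<^sup>2) ^ 3 + K * (27 / (e\<^sup>2) ^ 3)"
  have "\<bar>binom_cdf n j p - edgeworth n (j + 1/2) p\<bar> \<le> C / real n ^ 3"
    if n: "n > 0" and p: "0 < p" "p < 1" and s: "sdev (real n) p \<ge> 1"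
      and far: "\<bar>real j + 1/2 - n * p\<bar> \<ge> e * n" for n j p
  proof -
    define y where "y = ystd n (j + 1/2) p"
    define w where "w = 1 / sdev n p"
    have s2: "(sdev n p)\<^sup>2 = n * (p * (1 - p))" using n p by (intro sdev_square) auto
    \<comment> \<open>From p q \<le> 1/4: y^2 = (j + 1/2 - n p)^2 / (n p q) is at least (e n)^2 / (n
      / 4).\<close>
    have y2: "y\<^sup>2 \<ge> 4 * e\<^sup>2 * n"
    proof -
      have "p * (1 - p) \<le> 1/4" using sum_power2_ge_zero[of "p - 1/2" 0]
        by (simp add: power2_eq_square algebra_simps)
      then have "(sdev n p)\<^sup>2 \<le> n * (1/4)" unfolding s2 by (intro mult_left_mono) auto
      then have "4 * e\<^sup>2 * n * (sdev n p)\<^sup>2 \<le> 4 * e\<^sup>2 * n * (n * (1/4))"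
        by (intro mult_left_mono) auto
      also have "\<dots> = (e * n)\<^sup>2" by (simp add: power2_eq_square)
      also have "\<dots> \<le> \<bar>real j + 1/2 - n * p\<bar>\<^sup>2" using far e by (intro power_mono) auto
      also have "\<dots> = y\<^sup>2 * (sdev n p)\<^sup>2"
        using s by (simp add: y_def ystd_def power_divide)
      finally show ?thesis using s by (auto simp: mult_le_cancel_right)
    qed
    have y6: "15 / y ^ 6 \<le> 15 / (4 * e\<^sup>2) ^ 3 / n ^ 3"
    proof -
      have "(4 * e\<^sup>2 * n) ^ 3 \<le> (y\<^sup>2) ^ 3" using y2 e by (intro power_mono) auto
      moreover have "(4 * e\<^sup>2 * n) ^ 3 > 0" using e n by simp
      ultimately have "15 / y ^ 6 \<le> 15 / (4 * e\<^sup>2 * n) ^ 3"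
        by (intro divide_left_mono mult_pos_pos) (auto simp: power_mult[symmetric])
      then show ?thesis by (simp add: power_mult_distrib)
    qed
    have ex: "exp (- 2 * e\<^sup>2 * n) \<le> 27 / (2 * e\<^sup>2) ^ 3 / n ^ 3"
      using exp_minus_le_inverse_cube[of "2 * e\<^sup>2 * n"] e n by (simp add: power_mult_distrib)
    have "\<bar>std_normal_density y * eval3 edgeworth_poly p y w\<bar> \<le> K * exp (- y\<^sup>2 / 4)"
      using s p by (intro abs_std_normal_density_mult_le K) (auto simp: w_def)
    also have "\<dots> \<le> K * exp (- (e\<^sup>2 * n))" using K(1) y2 by simp
    also have "\<dots> \<le> K * (27 / (e\<^sup>2 * n) ^ 3)"
      using K(1) e n by (intro mult_left_mono exp_minus_le_inverse_cube) auto
    finally have Q: "\<bar>std_normal_density y * eval3 edgeworth_poly p y w\<bar> \<le> K * (27 / (e\<^sup>2) ^ 3) / n ^ 3"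
      by (simp add: power_mult_distrib)
    have "\<bar>binom_cdf n j p - Phi y\<bar> \<le> exp (- 2 * e\<^sup>2 * n) + 15 / y ^ 6"
    proof (cases "real j + 1/2 - n * p < 0")
      case True
      then have "y < 0" using s by (simp add: y_def ystd_def divide_less_0_iff)
      moreover have "binom_cdf n j p \<ge> 0" using p by (simp add: binom_cdf_eq_prob)
      ultimately show ?thesis
        using binom_cdf_lower_tail[of p n e j] Phi_lower_tail[of y] Phi_nonneg[of y] True far n e p
        by auto
    next
      case False
      moreover have "e * n > 0" using e n by simp
      ultimately have "y > 0" using s far by (auto simp add: y_def ystd_def)
      moreover have "binom_cdf n j p \<le> 1" using p by (simp add: binom_cdf_eq_prob)
      ultimately show ?thesis
        using binom_cdf_upper_tail[of p n e j] Phi_upper_tail[of y] Phi_le_1[of y] False far n e p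
        by auto
    qed
    then show ?thesis
      using Q ex y6 unfolding edgeworth_def y_def[symmetric] w_def[symmetric] C_def
      by (simp add: add_divide_distrib)
  qed
  moreover have "C > 0" using e K(1) by (auto simp: C_def intro!: add_pos_pos)
  ultimately show ?thesis by blast
qed

section \<open>Comparison with the barrier\<close>

text \<open>The assumption on y d keeps m between s/2 and 3 s/2. So - m^2 gives - s^2 / 4 and the
  next term - y^2 s^2 / 8; as s \<ge> 8, the term linear in y costs at most (1 + y^2) s^2 /
  32.\<close>

lemma barrier_residual_bound:
  fixes y s d u m :: real
  defines "m \<equiv> s + y * d / 2"
  assumes "s \<ge> 8" "\<bar>d\<bar> \<le> 1" "u \<ge> 0" and yd: "\<bar>y * d\<bar> \<le> s"
  shows "- m\<^sup>2 + y\<^sup>2 * m * (m / 2 - s) - y * s * d / 2 - y\<^sup>2 * (d\<^sup>2 / 2 + u) \<le> - s\<^sup>2 / 8"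
proof -
  have m: "m \<ge> s / 2" "m \<le> 3 / 2 * s" using yd by (auto simp: m_def abs_le_iff)
  have "m\<^sup>2 \<ge> (s/2)\<^sup>2" using m assms by (intro power_mono) auto
  then have 1: "m\<^sup>2 \<ge> s\<^sup>2 / 4" by (simp add: power_divide)
  have "(s/2) * (s/4) \<le> m * (s - m/2)" using m \<open>s \<ge> 8\<close> by (intro mult_mono; linarith)
  then have "m * (m / 2 - s) \<le> - s\<^sup>2 / 8" by (simp add: algebra_simps power2_eq_square)
  then have "y\<^sup>2 * (m * (m / 2 - s)) \<le> y\<^sup>2 * (- s\<^sup>2 / 8)" by (intro mult_left_mono) auto
  then have 2: "y\<^sup>2 * m * (m / 2 - s) \<le> - (y\<^sup>2 * s\<^sup>2) / 8" by (simp add: mult.assoc)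
  have 3: "- y * s * d / 2 \<le> (1 + y\<^sup>2) * s\<^sup>2 / 32"
  proof -
    have "2 * \<bar>y\<bar> \<le> 1 + y\<^sup>2" using sum_power2_ge_zero[of "\<bar>y\<bar> - 1" 0] by (simp add: power2_diff)
    then have "\<bar>y\<bar> \<le> (1 + y\<^sup>2) / 2" by simp
    moreover have "s \<le> s\<^sup>2 / 8" using assms by (simp add: power2_eq_square)
    ultimately have "\<bar>y\<bar> * s \<le> (1 + y\<^sup>2) / 2 * (s\<^sup>2 / 8)"
      using assms by (intro mult_mono) auto
    moreover have "- (y * d) * s \<le> \<bar>y\<bar> * s"
    proof (intro mult_right_mono)
      have "- (y * d) \<le> \<bar>y\<bar> * \<bar>d\<bar>" by (simp add: abs_mult[symmetric])
      also have "\<dots> \<le> \<bar>y\<bar> * 1" using assms by (intro mult_left_mono) auto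
      finally show "- (y * d) \<le> \<bar>y\<bar>" by simp
    qed (use assms in auto)
    ultimately show ?thesis by (simp add: algebra_simps)
  qed
  have 4: "y\<^sup>2 * (d\<^sup>2 / 2 + u) \<ge> 0" using assms by simp
  have 5: "s\<^sup>2 \<ge> 0" "y\<^sup>2 * s\<^sup>2 \<ge> 0" by auto
  from 3 have 3: "- (y * s * d / 2) \<le> s\<^sup>2 / 32 + y\<^sup>2 * s\<^sup>2 / 32" by (simp add: algebra_simps)
  show ?thesis using 1 2 3 4 5 by linarith
qed

lemma binom_cdf_edgeworth_uniform:
  assumes \<delta>: "0 < \<delta>" "\<delta> \<le> 1/2"
  shows "\<exists>C>0. \<forall>n j p. real n \<ge> 256 / \<delta> \<longrightarrow> j \<le> n \<longrightarrow> \<delta> \<le> p \<longrightarrow> p \<le> 1 - \<delta> \<longrightarrow>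
           \<bar>binom_cdf n j p - edgeworth n (j + 1/2) p\<bar> \<le> C * (1 / real n powr (5/2))"
proof -
  \<comment> \<open>With this choice the interval of radius e around a / n stays within 2 e =
    \<delta> / 2 of p, and e is at most x (1 - x) on it.\<close>
  define e where "e = \<delta> / 4"
  have e: "e > 0" using \<delta> by (simp add: e_def)
  obtain C1 where C1: "C1 > 0" "\<And>n j p. n > 0 \<Longrightarrow> 0 < p \<Longrightarrow> p < 1 \<Longrightarrow> sdev (real n) p \<ge> 1 \<Longrightarrow>
      \<bar>real j + 1/2 - n * p\<bar> \<ge> e * n \<Longrightarrow>
      \<bar>binom_cdf n j p - edgeworth n (j + 1/2) p\<bar> \<le> C1 / real n ^ 3"
    using binom_cdf_edgeworth_far[OF e] by blast
  obtain R where R: "residual_poly = wvar ^ 5 * R" using wvar_power5_dvd_residual_poly by (auto simp: dvd_def)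
  have eval_R: "eval3 residual_poly p y w = w ^ 5 * eval3 R p y w" for p y w
    by (simp add: R eval3_mult eval3_vars power_numeral_reduce eval3_1)
  obtain K where K: "K > 0" "\<And>p w y. p \<in> {0..1} \<Longrightarrow> w \<in> {0..1} \<Longrightarrow>
      \<bar>eval3 R p y w\<bar> \<le> K * exp (1/4 * y\<^sup>2)"
    using eval3_bound[of "1/4" R] by auto
  \<comment> \<open>The 17 is any number above 16: the barrier's residual provides the factor 1/2 *
    1/8 = 1/16, and strict inequality is needed.\<close>
  define C where "C = C1 + 17 * K / sqrt (\<delta> / 4) ^ 5"
  have "\<bar>binom_cdf n j p - edgeworth n (j + 1/2) p\<bar> \<le> C * (1 / real n powr (5/2))"
    if n: "real n \<ge> 256 / \<delta>" and j: "j \<le> n" and p: "\<delta> \<le> p" "p \<le> 1 - \<delta>" for n j p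
  proof -
    have "1 \<le> 256 / \<delta>" using \<delta> by (simp add: field_simps)
    then have n0: "real n > 0" "real n \<ge> 1" using n by linarith+
    have n52: "real n powr (5/2) = sqrt n ^ 5"
      using n0 by (simp add: powr_half_sqrt[symmetric] powr_power)
    have n3: "C1 / real n ^ 3 \<le> C1 * (1 / real n powr (5/2))"
    proof -
      have "real n powr (5/2) \<le> real n powr 3" using n0 by (intro powr_mono) auto
      also have "\<dots> = real n ^ 3" using n0 by (simp add: powr_numeral)
      finally have "C1 / real n ^ 3 \<le> C1 / real n powr (5/2)"
        using n0 C1(1) by (intro divide_left_mono) auto
      then show ?thesis by simp
    qed
    \<comment> \<open>The bound 256 / \<delta> on n makes n x (1 - x) \<ge> n \<delta> / 4 \<ge> 64,
      which gives the \<open>sdev\<close> of at least 8 wanted by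
      \<open>barrier_residual_bound\<close>.\<close>
    have x_bounds: "0 < x \<and> x < 1 \<and> x * (1 - x) \<ge> \<delta> / 4 \<and> sdev n x \<ge> 8
          \<and> sdev n x \<ge> sqrt (\<delta> / 4) * sqrt n"
      if "\<delta> / 2 \<le> x" "x \<le> 1 - \<delta> / 2" for x
    proof -
      have x: "0 < x" "x < 1" using that \<delta> by auto
      have "(x - \<delta>/2) * ((1 - x) - \<delta>/2) \<ge> 0" using that by simp
      then have "x * (1 - x) \<ge> \<delta>/2 * (1 - \<delta>/2)" by (simp add: algebra_simps)
      moreover have "\<delta>/2 * (1 - \<delta>/2) \<ge> \<delta>/2 * (1/2)" using \<delta> by (intro mult_left_mono) auto
      ultimately have u: "x * (1 - x) \<ge> \<delta> / 4" by simp
      have "n * (x * (1 - x)) \<ge> n * (\<delta>/4)" using u by (intro mult_left_mono) auto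
      moreover have "n * (\<delta>/4) \<ge> 256 / \<delta> * (\<delta>/4)" using \<delta> n by (intro mult_right_mono) auto
      then have "n * (\<delta>/4) \<ge> 64" using \<delta> by simp
      ultimately have V: "n * x * (1 - x) \<ge> \<delta> / 4 * n" "n * x * (1 - x) \<ge> 8\<^sup>2"
        unfolding mult.assoc[of "real n"] by (simp_all add: mult.commute[of \<delta>])
      show ?thesis using x u V by (auto simp: sdev_def real_sqrt_mult[symmetric] intro!: real_le_rsqrt)
    qed
    show ?thesis
    proof (cases "\<bar>real j + 1/2 - n * p\<bar> \<ge> e * n")
      case True
      have "\<bar>binom_cdf n j p - edgeworth n (j + 1/2) p\<bar> \<le> C1 / real n ^ 3"
        using x_bounds[of p] p \<delta> n0 True by (intro C1(2)) auto
      also note n3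
      also have "C1 * (1 / real n powr (5/2)) \<le> C * (1 / real n powr (5/2))"
        using K(1) \<delta> by (intro mult_right_mono) (auto simp: C_def)
      finally show ?thesis .
    next
      case False
      define a where "a = real j + 1/2"
      define l r where "l = a / n - e" and "r = a / n + e"
      have "\<bar>a / n - p\<bar> < e"
      proof -
        have "\<bar>a / n - p\<bar> * n = \<bar>(a / n - p) * n\<bar>" by (simp add: abs_mult)
        also have "(a / n - p) * n = a - n * p" using n0 by (simp add: algebra_simps)
        also have "\<bar>a - n * p\<bar> < e * n" using False by (simp add: a_def)
        finally show ?thesis using n0 by (simp add: mult_less_cancel_right)
      qed
      then have pl: "p \<in> {l..r}" and lr: "\<delta> / 2 \<le> l" "r \<le> 1 - \<delta> / 2" "l \<le> r"
        using p e unfolding l_def r_def e_def atLeastAtMost_iff by linarith+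
      define D where "D x = binom_cdf n j x - edgeworth n a x" for x
      define D' where "D' x = binom_cdf' n j x - edgeworth' n a x" for x
      define A where "A = 17 * K / (sqrt (\<delta> / 4) * sqrt n) ^ 5"
      have A: "A > 0" using K(1) \<delta> n0 by (simp add: A_def)
      \<comment> \<open>At the end points the distance of a from n x is exactly e n, so the far
        estimate applies.\<close>
      have boundary: "\<bar>D x\<bar> \<le> C1 / real n ^ 3" if "x = l \<or> x = r" for x
      proof -
        have "\<bar>a - n * x\<bar> \<ge> e * n" using that n0 e by (auto simp: l_def r_def field_simps)
        then show ?thesis
          using that lr x_bounds[of x] n0 unfolding D_def a_def by (intro C1(2)) auto
      qed
      \<comment> \<open>The signs 1 and -1 together give the two-sided bound.\<close>
      have main: "\<sigma> * D p \<le> A + C1 / real n ^ 3" if \<sigma>: "\<bar>\<sigma>\<bar> = 1" for \<sigma>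
      proof -
        define f where "f x = \<sigma> * D x - A * barrier n a x" for x
        define f' where "f' x = \<sigma> * D' x - A * barrier' n a x" for x
        define g where "g x = std_normal_density (ystd n a x) * (sdev n x)\<^sup>2
             * eval3 residual_poly x (ystd n a x) (1 / sdev n x)" for x
        define h where "h x = (let y = ystd n a x; s = sdev n x; d = 1 - 2 * x; m = s + y * d / 2 in
             - m\<^sup>2 + y\<^sup>2 * m * (m / 2 - s) - y * s * d / 2 - y\<^sup>2 * (d\<^sup>2 / 2 + x * (1 - x)))" for x
        have f: "(f has_real_derivative f' x) (at x)" if "x \<in> {l..r}" for x
        proof -
          have x: "0 < x" "x < 1" using x_bounds[of x] that lr by auto
          show ?thesis unfolding f_def f'_def D_def D'_def
            by (intro DERIV_diff DERIV_cmult has_real_derivative_binom_cdf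
                has_real_derivative_edgeworth has_real_derivative_barrier j n0 x)
        qed
        \<comment> \<open>The binomial part solves the equation exactly, so only the residuals of
          the expansion and of the barrier remain.\<close>
        have f': "(f' has_real_derivative drift n a x * f' x
             + (- \<sigma> * g x - A * (barrier n a x / 2 * h x)) / (x * (1 - x))\<^sup>2) (at x)"
          if "x \<in> {l..r}" for x
        proof -
          have x: "0 < x" "x < 1" using x_bounds[of x] that lr by auto
          have "(f' has_real_derivative
              \<sigma> * (drift n a x * binom_cdf' n j x
                   - (drift n a x * edgeworth' n a x + g x / (x * (1 - x))\<^sup>2))
              - A * (drift n a x * barrier' n a x + barrier n a x / 2 * h x / (x * (1 - x))\<^sup>2)) (at x)"
            unfolding f'_def D'_def g_def h_def Let_def
            by (intro DERIV_diff DERIV_cmult has_real_derivative_edgeworth'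
                has_real_derivative_barrier' n0 x
                has_real_derivative_binom_cdf'[OF j x, folded a_def])
          then show ?thesis
            by (rule DERIV_cong)
               (simp add: f'_def D'_def diff_divide_distrib add_divide_distrib algebra_simps)
        qed
        have pos: "(- \<sigma> * g x - A * (barrier n a x / 2 * h x)) / (x * (1 - x))\<^sup>2 > 0"
          if "x \<in> {l..r}" for x
        proof -
          have x: "0 < x" "x < 1" "x * (1 - x) \<ge> \<delta> / 4" "sdev n x \<ge> 8"
            "sdev n x \<ge> sqrt (\<delta> / 4) * sqrt n"
            using x_bounds[of x] that lr by auto
          define y s where "y = ystd n a x" and "s = sdev n x"
          have s: "s \<ge> 8" "s \<ge> sqrt (\<delta> / 4) * sqrt n" using x by (auto simp: s_def)
          define E where "E = exp (- y\<^sup>2 / 4)"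
          have E: "E > 0" by (simp add: E_def)
          \<comment> \<open>On the interval, the distance of a / n from x is at most e \<le> x (1 -
            x). Multiplying by n bounds the distance of a from n x by s^2, and dividing by s gives
            the claim.\<close>
          have ys: "\<bar>y\<bar> \<le> s"
          proof -
            have s2: "s * s = n * (x * (1 - x))"
              using sdev_square[of n x] n0 x by (simp add: s_def power2_eq_square)
            have "\<bar>a / n - x\<bar> \<le> e" using that unfolding l_def r_def atLeastAtMost_iff by linarith
            then have "n * \<bar>a / n - x\<bar> \<le> n * (x * (1 - x))"
              using x(3) by (intro mult_left_mono) (auto simp: e_def)
            also have "n * \<bar>a / n - x\<bar> = \<bar>n * (a / n - x)\<bar>" by (simp add: abs_mult)
            also have "n * (a / n - x) = a - n * x" using n0 by (simp add: algebra_simps)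
            finally have "\<bar>a - n * x\<bar> \<le> s * s" by (simp add: s2)
            then show ?thesis using s(1) by (simp add: y_def ystd_def s_def[symmetric] field_simps)
          qed
          have d: "\<bar>1 - 2 * x\<bar> \<le> 1" using x by auto
          have "\<bar>y * (1 - 2 * x)\<bar> \<le> s"
            using mult_mono[OF ys d] s(1) by (simp add: abs_mult)
          then have h: "h x \<le> - s\<^sup>2 / 8"
            unfolding h_def Let_def y_def[symmetric] s_def[symmetric]
            using s d x by (intro barrier_residual_bound) auto
          have dens: "\<bar>std_normal_density y * eval3 R x y (1/s)\<bar> \<le> K * E"
            unfolding E_def using s x by (intro abs_std_normal_density_mult_le K) auto
          \<comment> \<open>The factor w^5 of the residual supplies the order n^(-5/2); A was chosen
            to match it.\<close>
          have "(1/s) ^ 5 \<le> (1 / (sqrt (\<delta> / 4) * sqrt n)) ^ 5"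
            using s \<delta> n0 by (intro power_mono divide_left_mono) auto
          also have "\<dots> = A / (17 * K)" using K(1) by (simp add: A_def power_divide)
          finally have w5: "(1/s) ^ 5 \<le> A / (17 * K)" .
          have "\<bar>g x\<bar> = \<bar>std_normal_density y * eval3 R x y (1/s)\<bar> * (s\<^sup>2 * (1/s) ^ 5)"
            using s(1) unfolding g_def eval_R y_def[symmetric] s_def[symmetric]
            by (simp add: abs_mult mult_ac)
          also have "\<dots> \<le> K * E * (s\<^sup>2 * (A / (17 * K)))"
            using K(1) E s(1) by (intro mult_mono[OF dens] mult_left_mono[OF w5]) auto
          finally have "\<bar>g x\<bar> \<le> K * E * (s\<^sup>2 * (A / (17 * K)))" .
          then have g: "\<bar>g x\<bar> \<le> A * E * s\<^sup>2 / 17" using K(1) by (simp add: field_simps)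
          have "A * (E / 2 * h x) \<le> A * (E / 2 * (- s\<^sup>2 / 8))"
            using A E h by (intro mult_left_mono) auto
          then have "A * (E / 2 * h x) \<le> - (A * E * s\<^sup>2) / 16" by simp
          moreover have "- \<sigma> * g x \<ge> - \<bar>g x\<bar>"
            using \<sigma> by (metis abs_ge_minus_self abs_minus_cancel abs_mult minus_le_iff mult_1)
          moreover have "A * E * s\<^sup>2 > 0" using A E s by simp
          ultimately have "- \<sigma> * g x - A * (E / 2 * h x) > 0" using g by linarith
          then show ?thesis using x by (simp add: barrier_def y_def E_def)
        qed
        have "f p \<le> max (f l) (f r)"
          by (rule maximum_principle[OF f f' pos pl])
        also have "\<dots> \<le> C1 / real n ^ 3"
        proof -
          have "f x \<le> C1 / real n ^ 3" if "x = l \<or> x = r" for x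
          proof -
            have "\<sigma> * D x \<le> \<bar>\<sigma> * D x\<bar>" by simp
            also have "\<dots> \<le> C1 / real n ^ 3" using boundary[OF that] \<sigma> by (simp add: abs_mult)
            moreover have "A * barrier n a x \<ge> 0" using A by (simp add: barrier_def)
            ultimately show ?thesis by (simp add: f_def)
          qed
          then show ?thesis by simp
        qed
        finally have "\<sigma> * D p \<le> A * barrier n a p + C1 / real n ^ 3" by (simp add: f_def)
        also have "A * barrier n a p \<le> A * 1" using A by (intro mult_left_mono) (auto simp: barrier_def)
        finally show ?thesis by simp
      qed
      have "\<bar>D p\<bar> \<le> A + C1 / real n ^ 3" using main[of 1] main[of "-1"] by auto
      also have "\<dots> \<le> A + C1 * (1 / real n powr (5/2))" using n3 by simp
      also have "\<dots> = C * (1 / real n powr (5/2))"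
        unfolding A_def C_def n52 by (simp add: power_mult_distrib add_divide_distrib)
      finally show ?thesis by (simp add: D_def a_def)
    qed
  qed
  moreover have "C > 0" using C1(1) K(1) \<delta> by (auto simp: C_def intro!: add_pos_pos)
  ultimately show ?thesis by blast
qed

section \<open>Return to the stated expansion\<close>

lemma eval3_edgeworth_poly:
  "eval3 edgeworth_poly p y w =
     (1/6) * ((1 - p) - p) * (1 - y^2) * w
   + y * ((1/72) * (-3 + 7*y^2 - y^4) - (p * (1 - p) / 36) * (-3 + 11*y^2 - 2*y^4)) * w ^ 2
   + ((1 - p) - p) * ((1/6480) * (123 + 129*y^2 - 384*y^4 + 95*y^6 - 5*y^8)
       - (p * (1 - p) / 3240) * (3 + 69*y^2 - 399*y^4 + 145*y^6 - 10*y^8)) * w ^ 3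
   + y * ((1/155520) * (-4293 - 1359*y^2 + 6165*y^4 - 1971*y^6 + 185*y^8 - 5*y^10)
       + (p * (1 - p) / 38880) * (3105 + 1395*y^2 - 7794*y^4 + 2979*y^6 - 325*y^8 + 10*y^10)
       + (p^2 * (1 - p)^2 / 38880) * (135 - 1035*y^2 + 7947*y^4 - 4167*y^6 + 560*y^8 - 20*y^10)) * w ^ 4"
  unfolding edgeworth_poly_def eval3_pCons eval2_pCons eval3_0 eval2_0 poly_pCons poly_0
  by algebra

theorem theorem3p1:
  fixes p :: "nat \<Rightarrow> real" and j :: "nat \<Rightarrow> nat"
  assumes "0 < liminf (\<lambda>n. ereal (p n))"
      and "limsup (\<lambda>n. ereal (p n)) < 1"
      and "\<And>n. j n \<le> n"
  shows "(\<lambda>n. let q = 1 - p n; V = real n * p n * q;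
               y = (real (j n) - real n * p n + 1/2) / sqrt V;
               P1 = (1/6) * (q - p n) * (1 - y^2);
               P2 = y * ((1/72) * (-3 + 7*y^2 - y^4)
                         - (p n * q / 36) * (-3 + 11*y^2 - 2*y^4));
               P3 = (q - p n) * ((1/6480) * (123 + 129*y^2 - 384*y^4 + 95*y^6 - 5*y^8)
                         - (p n * q / 3240) * (3 + 69*y^2 - 399*y^4 + 145*y^6 - 10*y^8));
               P4 = y * ((1/155520) * (-4293 - 1359*y^2 + 6165*y^4 - 1971*y^6 + 185*y^8 - 5*y^10)
                         + (p n * q / 38880) * (3105 + 1395*y^2 - 7794*y^4 + 2979*y^6 - 325*y^8 + 10*y^10)
                         + ((p n)^2 * q^2 / 38880) * (135 - 1035*y^2 + 7947*y^4 - 4167*y^6 + 560*y^8 - 20*y^10))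
           in (\<Sum>k=0..j n. real (n choose k) * p n ^ k * q ^ (n - k))
              - (Phi y + exp (- (y^2) / 2) / sqrt (2 * pi)
                   * (P1 / sqrt V + P2 / V + P3 / V powr (3/2) + P4 / V^2)))
         \<in> O(\<lambda>n. 1 / real n powr (5/2))"
  (is "?F \<in> _")
proof -
  \<comment> \<open>Real numbers strictly below the limit inferior and strictly above the limit
    superior confine p n eventually to [\<delta>, 1 - \<delta>], where the uniform estimate
    holds.\<close>
  obtain a where a: "0 < ereal a" "ereal a < liminf (\<lambda>n. ereal (p n))"
    using ereal_dense2[OF assms(1)] by blast
  obtain b where b: "limsup (\<lambda>n. ereal (p n)) < ereal b" "ereal b < 1"
    using ereal_dense2[OF assms(2)] by blast
  define \<delta> where "\<delta> = min (1/2) (min a (1 - b))"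
  have \<delta>: "0 < \<delta>" using a b by (simp add: \<delta>_def one_ereal_def)
  moreover have "\<delta> \<le> 1/2" unfolding \<delta>_def by (rule min.cobounded1)
  ultimately obtain C where C: "\<And>n j p. real n \<ge> 256 / \<delta> \<Longrightarrow> j \<le> n \<Longrightarrow> \<delta> \<le> p \<Longrightarrow> p \<le> 1 - \<delta> \<Longrightarrow>
      \<bar>binom_cdf n j p - edgeworth n (j + 1/2) p\<bar> \<le> C * (1 / real n powr (5/2))"
    using binom_cdf_edgeworth_uniform by blast
  have ev: "\<forall>\<^sub>F n in sequentially. real n \<ge> 256 / \<delta>"
    using filterlim_real_sequentially by (simp add: filterlim_at_top)
  have "\<forall>\<^sub>F n in sequentially. norm (?F n) \<le> C * norm (1 / real n powr (5/2))"
    using less_LiminfD[OF a(2)] Limsup_lessD[OF b(1)] ev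
  proof eventually_elim
    case (elim n)
    have p: "\<delta> \<le> p n" "p n \<le> 1 - \<delta>" using elim by (auto simp: \<delta>_def)
    have "256 / \<delta> > 0" using \<delta> by simp
    then have n0: "real n > 0" using elim by linarith
    have s: "sdev n (p n) > 0" using p \<delta> n0 by (intro sdev_pos) auto
    define V where "V = real n * p n * (1 - p n)"
    have sq: "sqrt V = sdev n (p n)" by (simp add: sdev_def V_def)
    have V: "V = sdev n (p n) ^ 2" using s by (simp add: sq[symmetric])
    have V32: "V powr (3/2) = sdev n (p n) ^ 3"
    proof -
      have "V = sdev n (p n) powr 2" using s by (simp add: V)
      then have "V powr (3/2) = sdev n (p n) powr 3" by (simp only: powr_powr) simp
      then show ?thesis using s by simp
    qed
    have V2: "V ^ 2 = sdev n (p n) ^ 4" unfolding V by (simp add: power_mult[symmetric])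
    have y: "(real (j n) - real n * p n + 1/2) / sdev n (p n) = ystd n (real (j n) + 1/2) (p n)"
      by (simp add: ystd_def)
    have "?F n = binom_cdf n (j n) (p n) - edgeworth n (real (j n) + 1/2) (p n)"
      unfolding Let_def V_def[symmetric] sq V32 V2 y edgeworth_def binom_cdf_def
        eval3_edgeworth_poly std_normal_density_def
      unfolding V by (simp add: power_divide)
    then show ?case using C[OF elim(3) assms(3) p] by simp
  qed
  then show ?thesis by (rule bigoI)
qed

end
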